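(* Let $H$ be a real Hilbert space and let $A:D(A)\subset H\to H$ be a (possibly set-valued) maximal monotone operator with $F:=A^{-1}0=\{x\in D(A): 0\in Ax\}\neq\emptyset$. Let $(\beta_n)_{n\ge 0}$ be a sequence in $(0,\infty)$ with $\beta_n\to\infty$, let $(\alpha_n)_{n\ge 0}$ be a sequence in $\mathbb{R}$ with $\alpha_n\to 0$, let $(e_n)_{n\ge 0}$ be a sequence in $H$ with $\alpha_n e_n\to 0$ in norm, and let $(u_n)_{n\ge 0}$ be a sequence in $H$ with $u_n\to u$ in norm for some $u\in H$. Then for every $x_0\in H$ the sequence $(x_n)$ defined by $$x_{n+1}=(I+\beta_nA)^{-1}\big(u_n+\alpha_n(x_n+e_n)\big),\qquad n\ge 0,$$ converges strongly (in norm) to $P_Fu$, the metric projection of $u$ onto $F$.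
   Context: Let $H$ be a real Hilbert space with scalar product $(\cdot,\cdot)$ and norm $\|\cdot\|$. A possibly set-valued operator $A:D(A)\subset H\to H$ is identified with its graph $G(A)=\{[x,y]\in D(A)\times H: y\in Ax\}$. It is monotone if $(x_1-x_2,y_1-y_2)\ge 0$ for all $[x_1,y_1],[x_2,y_2]\in G(A)$, and maximal monotone if in addition $G(A)$ is not properly contained in the graph of any other monotone operator in $H$. For a maximal monotone $A$ and $\lambda>0$, the range of $I+\lambda A$ is all of $H$, and the resolvent $J_\lambda=(I+\lambda A)^{-1}:H\to H$ is everywhere defined, single-valued and nonexpansive. The set $F=A^{-1}0$ is closed and convex, so, when it is nonempty, $P_Fu$ denotes the unique point of $F$ nearest to $u$. *)

theory Defs
  imports "HOL-Analysis.Analysis"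
begin

text \<open>
  A set-valued operator is a function \<open>'a \<Rightarrow> 'a set\<close> with value \<open>{}\<close> outside its domain.
\<close>

definition op_dom :: "('a \<Rightarrow> 'a set) \<Rightarrow> 'a set" where
  "op_dom A = {x. A x \<noteq> {}}"

definition op_graph :: "('a \<Rightarrow> 'a set) \<Rightarrow> ('a \<times> 'a) set" where
  "op_graph A = {(x, y). x \<in> op_dom A \<and> y \<in> A x}"

definition op_inverse :: "('a \<Rightarrow> 'a set) \<Rightarrow> 'a \<Rightarrow> 'a set" where
  "op_inverse A y = {x \<in> op_dom A. y \<in> A x}"

definition monotone_op :: "('a::real_inner \<Rightarrow> 'a set) \<Rightarrow> bool" where
  "monotone_op A \<longleftrightarrow>
    (\<forall>(x1, y1) \<in> op_graph A. \<forall>(x2, y2) \<in> op_graph A. (x1 - x2) \<bullet> (y1 - y2) \<ge> 0)"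

definition maximal_monotone_op :: "('a::real_inner \<Rightarrow> 'a set) \<Rightarrow> bool" where
  "maximal_monotone_op A \<longleftrightarrow>
    monotone_op A \<and> \<not> (\<exists>B. monotone_op B \<and> op_graph A \<subset> op_graph B)"

definition id_plus_scaled :: "real \<Rightarrow> ('a::real_vector \<Rightarrow> 'a set) \<Rightarrow> 'a \<Rightarrow> 'a set" where
  "id_plus_scaled c A x = {x + c *\<^sub>R y | y. y \<in> A x}"

text \<open>
  For maximal monotone \<open>A\<close> on a Hilbert space and \<open>c > 0\<close>, the set-valued inverse of \<open>I + cA\<close> has
  exactly one value at every point (Minty's theorem); the resolvent selects it.
\<close>

definition resolvent :: "real \<Rightarrow> ('a::real_vector \<Rightarrow> 'a set) \<Rightarrow> 'a \<Rightarrow> 'a" where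
  "resolvent c A z = (THE x. x \<in> op_inverse (id_plus_scaled c A) z)"

text \<open>
  The library's \<open>closest_point\<close> requires the class \<open>heine_borel\<close>, which excludes
  infinite-dimensional Hilbert spaces.
\<close>

definition metric_proj :: "'a::metric_space set \<Rightarrow> 'a \<Rightarrow> 'a" where
  "metric_proj S u = (THE p. p \<in> S \<and> (\<forall>q\<in>S. dist u p \<le> dist u q))"

end

theory Submission
  imports Defs
begin

text \<open>
  Minty's theorem comes from the Fitzpatrick function
  \<open>\<phi>(x, s) = sup {x \<bullet> b + a \<bullet> s - a \<bullet> b | [a, b] \<in> G(A)}\<close>. Since \<open>\<phi>(x, s) \<ge> x \<bullet> s\<close>, the strongly
  convex function \<open>\<phi>(q) + \<parallel>q\<parallel>\<^sup>2 / 2\<close> is nonnegative; it has a minimiser \<open>(x, s)\<close>, and its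
  quadratic growth there, tested on \<open>G(A)\<close>, gives \<open>- x \<in> A (- s)\<close> and \<open>x + s = 0\<close>.

  For the convergence, write \<open>J\<^sub>b = (I + b A)\<^sup>-\<^sup>1\<close>. Monotonicity gives the obtuse angle
  \<open>(J\<^sub>b u - q) \<bullet> (u - J\<^sub>b u) \<ge> 0\<close> both for \<open>q = J\<^sub>c u\<close> with \<open>c \<ge> b\<close> and for \<open>q \<in> F\<close>, and hence
  \<open>\<parallel>J\<^sub>b u - q\<parallel>\<^sup>2 \<le> \<parallel>u - q\<parallel>\<^sup>2 - \<parallel>u - J\<^sub>b u\<parallel>\<^sup>2\<close>. So \<open>\<parallel>u - J\<^sub>b u\<parallel>\<close> is bounded and increasing
  in \<open>b\<close>, and \<open>J\<^sub>b u\<close> converges strongly as \<open>b \<rightarrow> \<infinity>\<close>, without any appeal to weak compactness; the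
  obtuse angle with \<open>q \<in> F\<close> survives in the limit and characterises \<open>P\<^sub>F u\<close>. Nonexpansiveness of
  the resolvents makes \<open>(x\<^sub>n)\<close> a small perturbation of this convergence along \<open>b = \<beta>\<^sub>n\<close>.
\<close>

section \<open>Maximal monotone operators\<close>

lemma mem_op_graph_iff: "(x, y) \<in> op_graph A \<longleftrightarrow> y \<in> A x"
  by (auto simp: op_graph_def op_dom_def)

lemma mem_op_inverse_iff: "x \<in> op_inverse A y \<longleftrightarrow> y \<in> A x"
  by (auto simp: op_inverse_def op_dom_def)

lemma ball_op_graph_iff: "(\<forall>p\<in>op_graph A. P p) \<longleftrightarrow> (\<forall>x y. y \<in> A x \<longrightarrow> P (x, y))"
  by (simp add: Ball_def mem_op_graph_iff)

lemma monotone_op_iff: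
  "monotone_op A \<longleftrightarrow>
    (\<forall>x1 y1 x2 y2. y1 \<in> A x1 \<longrightarrow> y2 \<in> A x2 \<longrightarrow> 0 \<le> (x1 - x2) \<bullet> (y1 - y2))"
  by (auto simp: monotone_op_def ball_op_graph_iff)

lemma monotone_opD:
  "monotone_op A \<Longrightarrow> y1 \<in> A x1 \<Longrightarrow> y2 \<in> A x2 \<Longrightarrow> 0 \<le> (x1 - x2) \<bullet> (y1 - y2)"
  by (simp add: monotone_op_iff)

lemma maximal_monotone_op_imp_monotone_op: "maximal_monotone_op A \<Longrightarrow> monotone_op A"
  by (simp add: maximal_monotone_op_def)

lemma monotone_op_insert:
  assumes mono: "monotone_op A" and related: "\<And>a b. b \<in> A a \<Longrightarrow> 0 \<le> (x - a) \<bullet> (y - b)"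
  shows "monotone_op (A(x := insert y (A x)))"
proof -
  have "0 \<le> (a - x) \<bullet> (b - y)" if "b \<in> A a" for a b
    using related[OF that] by (metis inner_minus_left inner_minus_right minus_diff_eq)
  then show ?thesis
    using related monotone_opD[OF mono] by (auto simp: monotone_op_iff)
qed

lemma maximal_monotone_op_memI:
  assumes max: "maximal_monotone_op A" and related: "\<And>a b. b \<in> A a \<Longrightarrow> 0 \<le> (x - a) \<bullet> (y - b)"
  shows "y \<in> A x"
proof (rule ccontr)
  let ?B = "A(x := insert y (A x))"
  assume "y \<notin> A x"
  then have "(x, y) \<in> op_graph ?B - op_graph A"
    by (simp add: mem_op_graph_iff)
  moreover have "op_graph A \<subseteq> op_graph ?B"
    by (auto simp: mem_op_graph_iff)
  moreover have "monotone_op ?B"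
    using monotone_op_insert[OF maximal_monotone_op_imp_monotone_op[OF max] related] .
  ultimately show False
    using max unfolding maximal_monotone_op_def by blast
qed

lemma maximal_monotone_op_iff:
  "maximal_monotone_op A \<longleftrightarrow>
    (\<forall>x y. y \<in> A x \<longleftrightarrow> (\<forall>a b. b \<in> A a \<longrightarrow> 0 \<le> (x - a) \<bullet> (y - b)))"
    (is "_ \<longleftrightarrow> (\<forall>x y. _ \<longleftrightarrow> ?related x y)")
proof
  assume max: "maximal_monotone_op A"
  have "?related x y" if "y \<in> A x" for x y
    using monotone_opD[OF maximal_monotone_op_imp_monotone_op[OF max] that] by blast
  moreover have "y \<in> A x" if "?related x y" for x y
    by (rule maximal_monotone_op_memI[OF max]) (use that in blast)
  ultimately show "\<forall>x y. y \<in> A x \<longleftrightarrow> ?related x y"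
    by metis
next
  assume polar: "\<forall>x y. y \<in> A x \<longleftrightarrow> ?related x y"
  then have "?related x y" if "y \<in> A x" for x y
    using that by metis
  then have "monotone_op A"
    unfolding monotone_op_iff by metis
  moreover have "op_graph B \<subseteq> op_graph A" if "monotone_op B" "op_graph A \<subset> op_graph B" for B
  proof clarify
    fix x y
    assume "(x, y) \<in> op_graph B"
    moreover have "b \<in> B a" if "b \<in> A a" for a b
      using \<open>op_graph A \<subset> op_graph B\<close> that by (auto simp flip: mem_op_graph_iff)
    ultimately have "?related x y"
      using monotone_opD[OF \<open>monotone_op B\<close>] by (simp add: mem_op_graph_iff)
    then show "(x, y) \<in> op_graph A"
      unfolding mem_op_graph_iff using polar by metis
  qed
  ultimately show "maximal_monotone_op A"
    by (auto simp: maximal_monotone_op_def)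
qed

lemma maximal_monotone_op_mem_iff:
  "maximal_monotone_op A \<Longrightarrow> y \<in> A x \<longleftrightarrow> (\<forall>a b. b \<in> A a \<longrightarrow> 0 \<le> (x - a) \<bullet> (y - b))"
  unfolding maximal_monotone_op_iff by metis

lemma maximal_monotone_op_nonempty:
  assumes "maximal_monotone_op A"
  obtains a b where "b \<in> A a"
  using maximal_monotone_op_memI[OF assms] by blast

lemma closed_op_graph:
  assumes "maximal_monotone_op A"
  shows "closed (op_graph A)"
proof -
  have "op_graph A = {p. \<forall>a b. b \<in> A a \<longrightarrow> 0 \<le> (fst p - a) \<bullet> (snd p - b)}"
    unfolding set_eq_iff split_paired_All mem_op_graph_iff mem_Collect_eq fst_conv snd_conv
    by (intro allI maximal_monotone_op_mem_iff assms)
  also have "closed \<dots>"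
    by (intro closed_Collect_all closed_Collect_imp closed_Collect_le continuous_intros) auto
  finally show ?thesis .
qed

lemma maximal_monotone_op_affine:
  assumes max: "maximal_monotone_op A" and "c > 0"
  shows "maximal_monotone_op (\<lambda>x. (\<lambda>y. c *\<^sub>R y + z) ` A x)"
  unfolding maximal_monotone_op_iff
proof (intro allI)
  fix x w
  have scaled: "(x - a) \<bullet> (w - (c *\<^sub>R b + z)) = c * ((x - a) \<bullet> ((1 / c) *\<^sub>R (w - z) - b))" for a b
    using \<open>c > 0\<close> by (simp add: inner_diff inner_add field_simps)
  have "w \<in> (\<lambda>y. c *\<^sub>R y + z) ` A x \<longleftrightarrow> (1 / c) *\<^sub>R (w - z) \<in> A x"
    using \<open>c > 0\<close> by (force simp: image_iff)
  also have "\<dots> \<longleftrightarrow> (\<forall>a b. b \<in> A a \<longrightarrow> 0 \<le> (x - a) \<bullet> ((1 / c) *\<^sub>R (w - z) - b))"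
    by (rule maximal_monotone_op_mem_iff[OF max])
  also have "\<dots> \<longleftrightarrow> (\<forall>a b. b \<in> A a \<longrightarrow> 0 \<le> (x - a) \<bullet> (w - (c *\<^sub>R b + z)))"
    using \<open>c > 0\<close> by (simp add: scaled zero_le_mult_iff)
  also have "\<dots> \<longleftrightarrow> (\<forall>a b. b \<in> (\<lambda>y. c *\<^sub>R y + z) ` A a \<longrightarrow> 0 \<le> (x - a) \<bullet> (w - b))"
    by blast
  finally show "w \<in> (\<lambda>y. c *\<^sub>R y + z) ` A x \<longleftrightarrow> \<dots>" .
qed

section \<open>Minty's theorem\<close>

lemma Cauchy_if_dist_sq_le:
  fixes f :: "nat \<Rightarrow> 'a::metric_space" and d :: "nat \<Rightarrow> real"
  assumes "d \<longlonglongrightarrow> 0" and bound: "\<And>m n. m \<le> n \<Longrightarrow> (dist (f m) (f n))\<^sup>2 \<le> d m + d n"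
  shows "Cauchy f"
proof (rule metric_CauchyI)
  fix \<epsilon> :: real
  assume "\<epsilon> > 0"
  then have "\<forall>\<^sub>F n in sequentially. d n < \<epsilon>\<^sup>2 / 2"
    by (intro order_tendstoD(2)[OF \<open>d \<longlonglongrightarrow> 0\<close>]) simp
  then obtain N where N: "\<And>n. n \<ge> N \<Longrightarrow> d n < \<epsilon>\<^sup>2 / 2"
    by (auto simp: eventually_sequentially)
  have "dist (f m) (f n) < \<epsilon>" if "m \<ge> N" "n \<ge> N" for m n
  proof (rule power_less_imp_less_base)
    have "(dist (f m) (f n))\<^sup>2 \<le> d m + d n"
      using bound[of m n] bound[of n m] by (cases m n rule: le_cases) (simp_all add: dist_commute)
    then show "(dist (f m) (f n))\<^sup>2 < \<epsilon>\<^sup>2"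
      using N[OF \<open>m \<ge> N\<close>] N[OF \<open>n \<ge> N\<close>] by linarith
  qed (use \<open>\<epsilon> > 0\<close> in simp)
  then show "\<exists>N. \<forall>m\<ge>N. \<forall>n\<ge>N. dist (f m) (f n) < \<epsilon>"
    by blast
qed

text \<open>
  Minimising \<open>f + \<parallel>\<cdot>\<parallel>\<^sup>2 / 2\<close> amounts to minimising this function over the epigraph of \<open>f\<close>,
  which lets \<open>f\<close> take the value \<open>\<infinity>\<close>.
\<close>

definition prox_objective :: "'a::real_inner \<times> real \<Rightarrow> real" where
  "prox_objective p = snd p + (norm (fst p))\<^sup>2 / 2"

lemma prox_objective_convex_combination:
  "prox_objective ((1 - k) *\<^sub>R p + k *\<^sub>R p') =
    (1 - k) * prox_objective p + k * prox_objective p' -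
      k * (1 - k) / 2 * (dist (fst p) (fst p'))\<^sup>2"
proof -
  have "(norm ((1 - k) *\<^sub>R q + k *\<^sub>R q'))\<^sup>2 =
      (1 - k) * (norm q)\<^sup>2 + k * (norm q')\<^sup>2 - k * (1 - k) * (dist q q')\<^sup>2"
    for q q' :: 'a
    by (simp add: dist_norm power2_norm_eq_inner inner_commute algebra_simps)
  from this[of "fst p" "fst p'"] show ?thesis
    unfolding prox_objective_def fst_add snd_add fst_scaleR snd_scaleR by (simp add: field_simps)
qed

lemma prox_objective_minimizing_sequence_Cauchy:
  assumes "convex S" and lower: "\<And>r. r \<in> S \<Longrightarrow> m \<le> prox_objective r"
    and p: "\<And>n. p n \<in> S" and lim: "(\<lambda>n. prox_objective (p n)) \<longlonglongrightarrow> m"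
  shows "Cauchy (\<lambda>n. fst (p n))"
proof (rule Cauchy_if_dist_sq_le)
  have "(\<lambda>n. 4 * (prox_objective (p n) - m)) \<longlonglongrightarrow> 4 * (m - m)"
    by (intro tendsto_intros lim)
  then show "(\<lambda>n. 4 * (prox_objective (p n) - m)) \<longlonglongrightarrow> 0"
    by simp
next
  fix i j
  have "m \<le> prox_objective ((1 - 1/2) *\<^sub>R p i + (1/2) *\<^sub>R p j)"
    by (intro lower convexD_alt \<open>convex S\<close> p) simp_all
  then show "(dist (fst (p i)) (fst (p j)))\<^sup>2 \<le>
      4 * (prox_objective (p i) - m) + 4 * (prox_objective (p j) - m)"
    unfolding prox_objective_convex_combination by simp
qed

lemma prox_objective_attains_min:
  fixes S :: "('a::{real_inner, complete_space} \<times> real) set"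
  assumes "convex S" "closed S" "S \<noteq> {}" and bdd: "bdd_below (prox_objective ` S)"
  obtains p where "p \<in> S" "\<And>r. r \<in> S \<Longrightarrow> prox_objective p \<le> prox_objective r"
proof -
  define m where "m = Inf (prox_objective ` S)"
  have lower: "m \<le> prox_objective r" if "r \<in> S" for r
    unfolding m_def using bdd that by (auto intro: cInf_lower)
  have "m \<in> closure (prox_objective ` S)"
    unfolding m_def using \<open>S \<noteq> {}\<close> bdd by (intro closure_contains_Inf) auto
  then obtain v where "\<And>n. v n \<in> prox_objective ` S" "v \<longlonglongrightarrow> m"
    by (auto simp: closure_sequential)
  then obtain p where p: "\<And>n. p n \<in> S" and "v = (\<lambda>n. prox_objective (p n))"
    unfolding image_iff by metis
  with \<open>v \<longlonglongrightarrow> m\<close> have lim: "(\<lambda>n. prox_objective (p n)) \<longlonglongrightarrow> m"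
    by simp
  obtain q where q: "(\<lambda>n. fst (p n)) \<longlonglongrightarrow> q"
    using prox_objective_minimizing_sequence_Cauchy[OF \<open>convex S\<close> lower p lim]
    by (auto simp: Cauchy_convergent_iff convergent_def)
  have "(\<lambda>n. prox_objective (p n) - (norm (fst (p n)))\<^sup>2 / 2) \<longlonglongrightarrow> m - (norm q)\<^sup>2 / 2"
    by (intro tendsto_intros lim q) simp
  then have "(\<lambda>n. snd (p n)) \<longlonglongrightarrow> m - (norm q)\<^sup>2 / 2"
    by (simp add: prox_objective_def)
  from tendsto_Pair[OF q this] have "p \<longlonglongrightarrow> (q, m - (norm q)\<^sup>2 / 2)" (is "_ \<longlonglongrightarrow> ?p")
    by simp
  with \<open>closed S\<close> p have "?p \<in> S"
    by (rule closed_sequentially)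
  moreover have "prox_objective ?p = m"
    by (simp add: prox_objective_def)
  ultimately show thesis
    using that lower by metis
qed

lemma prox_objective_quadratic_growth:
  assumes "convex S" "p \<in> S" "r \<in> S"
    and min: "\<And>r. r \<in> S \<Longrightarrow> prox_objective p \<le> prox_objective r"
  shows "prox_objective p + (dist (fst p) (fst r))\<^sup>2 / 2 \<le> prox_objective r"
proof -
  have "l * ((dist (fst p) (fst r))\<^sup>2 / 2) \<le> prox_objective r - prox_objective p"
    if "0 < l" "l < 1" for l
  proof -
    have "prox_objective p \<le> prox_objective ((1 - (1 - l)) *\<^sub>R p + (1 - l) *\<^sub>R r)"
      using convexD_alt[OF \<open>convex S\<close> \<open>p \<in> S\<close> \<open>r \<in> S\<close>, of "1 - l"] that by (intro min) simp
    then have "(1 - l) * (l * ((dist (fst p) (fst r))\<^sup>2 / 2)) \<le>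
        (1 - l) * (prox_objective r - prox_objective p)"
      unfolding prox_objective_convex_combination by (simp add: algebra_simps)
    with \<open>l < 1\<close> show ?thesis
      by simp
  qed
  then have "(dist (fst p) (fst r))\<^sup>2 / 2 \<le> prox_objective r - prox_objective p"
    by (rule field_le_mult_one_interval)
  then show ?thesis
    by simp
qed

definition fitzpatrick_epigraph :: "('a::real_inner \<Rightarrow> 'a set) \<Rightarrow> (('a \<times> 'a) \<times> real) set" where
  "fitzpatrick_epigraph A = (\<Inter>(a, b) \<in> op_graph A. {p. ((b, a), - 1) \<bullet> p \<le> a \<bullet> b})"

lemma mem_fitzpatrick_epigraph_iff:
  "((x, s), t) \<in> fitzpatrick_epigraph A \<longleftrightarrow>
    (\<forall>a b. b \<in> A a \<longrightarrow> x \<bullet> s - (x - a) \<bullet> (s - b) \<le> t)"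
  by (simp add: fitzpatrick_epigraph_def ball_op_graph_iff inner_commute algebra_simps)

lemma closed_fitzpatrick_epigraph: "closed (fitzpatrick_epigraph A)"
  unfolding fitzpatrick_epigraph_def by (auto intro: closed_halfspace_le)

lemma convex_fitzpatrick_epigraph: "convex (fitzpatrick_epigraph A)"
  unfolding fitzpatrick_epigraph_def by (auto intro: convex_INT convex_halfspace_le)

lemma graph_mem_fitzpatrick_epigraph:
  assumes "monotone_op A" "b \<in> A a"
  shows "((a, b), a \<bullet> b) \<in> fitzpatrick_epigraph A"
  using monotone_opD[OF assms] by (simp add: mem_fitzpatrick_epigraph_iff)

lemma inner_le_fitzpatrick:
  assumes max: "maximal_monotone_op A" and mem: "((x, s), t) \<in> fitzpatrick_epigraph A"
  shows "x \<bullet> s \<le> t"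
proof (rule ccontr)
  assume "\<not> x \<bullet> s \<le> t"
  with mem have pos: "0 < (x - a) \<bullet> (s - b)" if "b \<in> A a" for a b
    using that unfolding mem_fitzpatrick_epigraph_iff by fastforce
  then have "s \<in> A x"
    by (intro maximal_monotone_op_memI[OF max] less_imp_le)
  from pos[OF this] show False
    by simp
qed

lemma half_norm_add_sq_le_prox_objective:
  assumes "maximal_monotone_op A" "((x, s), t) \<in> fitzpatrick_epigraph A"
  shows "(norm (x + s))\<^sup>2 / 2 \<le> prox_objective ((x, s), t)"
  using inner_le_fitzpatrick[OF assms]
  by (simp add: prox_objective_def power2_norm_eq_inner inner_add inner_commute field_simps)

lemma bdd_below_prox_objective_fitzpatrick:
  assumes "maximal_monotone_op A"
  shows "bdd_below (prox_objective ` fitzpatrick_epigraph A)"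
proof (rule bdd_belowI2)
  fix p
  assume "p \<in> fitzpatrick_epigraph A"
  moreover obtain x s t where "p = ((x, s), t)"
    by (metis surj_pair)
  ultimately have "(norm (x + s))\<^sup>2 / 2 \<le> prox_objective p"
    using half_norm_add_sq_le_prox_objective[OF assms] by blast
  then show "0 \<le> prox_objective p"
    by (rule order_trans[rotated]) simp
qed

lemma maximal_monotone_op_mem_neg:
  fixes A :: "'a::{real_inner, complete_space} \<Rightarrow> 'a set"
  assumes max: "maximal_monotone_op A"
  obtains x where "- x \<in> A x"
proof -
  let ?S = "fitzpatrick_epigraph A"
  have graph: "((a, b), a \<bullet> b) \<in> ?S" if "b \<in> A a" for a b
    using graph_mem_fitzpatrick_epigraph maximal_monotone_op_imp_monotone_op[OF max] that .
  have nonempty: "?S \<noteq> {}"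
    using maximal_monotone_op_nonempty[OF max] graph by (metis empty_iff)
  obtain p where "p \<in> ?S" and min: "\<And>r. r \<in> ?S \<Longrightarrow> prox_objective p \<le> prox_objective r"
    using prox_objective_attains_min[OF convex_fitzpatrick_epigraph closed_fitzpatrick_epigraph
        nonempty bdd_below_prox_objective_fitzpatrick[OF max]] by blast
  obtain x s t where p: "p = ((x, s), t)"
    by (metis surj_pair)
  have gap: "(norm (x + s))\<^sup>2 \<le> (- s - a) \<bullet> (- x - b)" if "b \<in> A a" for a b
  proof -
    have "(norm (x + s))\<^sup>2 / 2 + (dist (x, s) (a, b))\<^sup>2 / 2 \<le> prox_objective ((a, b), a \<bullet> b)"
      using prox_objective_quadratic_growth[OF convex_fitzpatrick_epigraph \<open>p \<in> ?S\<close>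
          graph[OF that] min]
        half_norm_add_sq_le_prox_objective[OF max, of x s t] \<open>p \<in> ?S\<close> by (simp add: p)
    then show ?thesis
      by (simp add: prox_objective_def dist_norm power2_norm_eq_inner inner_diff inner_add
          inner_commute field_simps)
  qed
  have "- x \<in> A (- s)"
    by (rule maximal_monotone_op_memI[OF max]) (rule order_trans[OF zero_le_power2 gap])
  moreover from gap[OF this] have "- s = x"
    by (simp add: neg_eq_iff_add_eq_0 add.commute)
  ultimately show thesis
    using that by metis
qed

theorem Minty_surjectivity:
  fixes A :: "'a::{real_inner, complete_space} \<Rightarrow> 'a set"
  assumes "maximal_monotone_op A" "c > 0"
  obtains x y where "y \<in> A x" "x + c *\<^sub>R y = z"
proof -
  obtain x where "- x \<in> (\<lambda>y. c *\<^sub>R y + - z) ` A x"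
    using maximal_monotone_op_mem_neg[OF maximal_monotone_op_affine[OF assms]] .
  then obtain y where "y \<in> A x" "- x = c *\<^sub>R y + - z"
    by blast
  then show thesis
    by (intro that[of y x]) (auto simp: algebra_simps)
qed

section \<open>Resolvents\<close>

lemma monotone_op_dist_le_dist_add_scaleR:
  assumes "monotone_op A" "c > 0" "y1 \<in> A x1" "y2 \<in> A x2"
  shows "dist x1 x2 \<le> dist (x1 + c *\<^sub>R y1) (x2 + c *\<^sub>R y2)"
proof -
  have "0 \<le> c * ((x1 - x2) \<bullet> (y1 - y2))"
    using monotone_opD[OF assms(1,3,4)] \<open>c > 0\<close> by simp
  also have "\<dots> = (x1 - x2) \<bullet> ((x1 + c *\<^sub>R y1) - (x2 + c *\<^sub>R y2)) - (norm (x1 - x2))\<^sup>2"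
    by (simp add: power2_norm_eq_inner algebra_simps)
  finally have "(norm (x1 - x2))\<^sup>2 \<le> (x1 - x2) \<bullet> ((x1 + c *\<^sub>R y1) - (x2 + c *\<^sub>R y2))"
    by simp
  also have "\<dots> \<le> norm (x1 - x2) * norm ((x1 + c *\<^sub>R y1) - (x2 + c *\<^sub>R y2))"
    by (rule norm_cauchy_schwarz)
  finally show ?thesis
    by (cases "x1 = x2") (auto simp: power2_eq_square dist_norm)
qed

lemma resolvent_eqI:
  assumes mono: "monotone_op A" and "c > 0" and y: "y \<in> A x"
  shows "resolvent c A (x + c *\<^sub>R y) = x"
  unfolding resolvent_def
proof (rule the_equality)
  show "x \<in> op_inverse (id_plus_scaled c A) (x + c *\<^sub>R y)"
    using y by (auto simp: mem_op_inverse_iff id_plus_scaled_def)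
next
  fix x'
  assume "x' \<in> op_inverse (id_plus_scaled c A) (x + c *\<^sub>R y)"
  then obtain y' where "y' \<in> A x'" "x + c *\<^sub>R y = x' + c *\<^sub>R y'"
    by (auto simp: mem_op_inverse_iff id_plus_scaled_def)
  then show "x' = x"
    using monotone_op_dist_le_dist_add_scaleR[OF mono \<open>c > 0\<close> _ y] by fastforce
qed

lemma resolvent_mem:
  fixes A :: "'a::{real_inner, complete_space} \<Rightarrow> 'a set"
  assumes max: "maximal_monotone_op A" and "c > 0"
  shows "(1 / c) *\<^sub>R (z - resolvent c A z) \<in> A (resolvent c A z)"
proof -
  obtain x y where "y \<in> A x" "x + c *\<^sub>R y = z"
    using Minty_surjectivity[OF assms] .
  with resolvent_eqI[OF maximal_monotone_op_imp_monotone_op[OF max] \<open>c > 0\<close>] \<open>c > 0\<close>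
  show ?thesis
    by auto
qed

lemma resolvent_nonexpansive:
  fixes A :: "'a::{real_inner, complete_space} \<Rightarrow> 'a set"
  assumes "maximal_monotone_op A" "c > 0"
  shows "dist (resolvent c A z) (resolvent c A w) \<le> dist z w"
  using monotone_op_dist_le_dist_add_scaleR[OF maximal_monotone_op_imp_monotone_op[OF assms(1)] \<open>c > 0\<close>
      resolvent_mem[OF assms, of z] resolvent_mem[OF assms, of w]] \<open>c > 0\<close> by simp

text \<open>
  The cases of interest are \<open>k = 0\<close>, where \<open>q\<close> is a zero of \<open>A\<close>, and \<open>k = 1 / c\<close>, where \<open>q\<close> is the
  resolvent at \<open>u\<close> with parameter \<open>c \<ge> b\<close>.
\<close>

lemma inner_resolvent_nonneg:
  fixes A :: "'a::{real_inner, complete_space} \<Rightarrow> 'a set"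
  assumes max: "maximal_monotone_op A" and "b > 0" and mem: "k *\<^sub>R (u - q) \<in> A q"
    and "0 \<le> k" "k * b \<le> 1"
  shows "0 \<le> (resolvent b A u - q) \<bullet> (u - resolvent b A u)"
proof -
  define d where "d = resolvent b A u - q"
  define w where "w = u - resolvent b A u"
  have "k *\<^sub>R (d + w) \<in> A q"
    using mem by (simp add: d_def w_def)
  then have "0 \<le> d \<bullet> ((1 / b) *\<^sub>R w - k *\<^sub>R (d + w))"
    unfolding d_def w_def
    by (rule monotone_opD[OF maximal_monotone_op_imp_monotone_op[OF max]
          resolvent_mem[OF max \<open>b > 0\<close>]])
  then have "0 \<le> b * (d \<bullet> ((1 / b) *\<^sub>R w - k *\<^sub>R (d + w)))"
    using \<open>b > 0\<close> by simp
  also have "\<dots> = (1 - k * b) * (d \<bullet> w) - k * b * (norm d)\<^sup>2"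
    using \<open>b > 0\<close> by (simp add: power2_norm_eq_inner inner_diff_right inner_add_right field_simps)
  finally have angle: "k * b * (norm d)\<^sup>2 \<le> (1 - k * b) * (d \<bullet> w)"
    by simp
  have "0 \<le> d \<bullet> w"
  proof (cases "k * b = 1")
    case True
    with angle show ?thesis
      by simp
  next
    case False
    have "0 \<le> k * b * (norm d)\<^sup>2"
      using assms by simp
    with angle have "0 \<le> (1 - k * b) * (d \<bullet> w)"
      by linarith
    with False \<open>k * b \<le> 1\<close> show ?thesis
      by (simp add: zero_le_mult_iff)
  qed
  then show ?thesis
    by (simp add: d_def w_def)
qed

lemma dist_sq_add_le_if_inner_nonneg:
  fixes u y q :: "'a::real_inner"
  assumes "0 \<le> (y - q) \<bullet> (u - y)"
  shows "(dist y q)\<^sup>2 + (dist u y)\<^sup>2 \<le> (dist u q)\<^sup>2"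
  using assms by (simp add: dist_norm power2_norm_eq_inner inner_diff inner_commute)

lemma metric_proj_eqI:
  fixes u p :: "'a::real_inner"
  assumes "p \<in> S" and angle: "\<And>q. q \<in> S \<Longrightarrow> 0 \<le> (p - q) \<bullet> (u - p)"
  shows "metric_proj S u = p"
  unfolding metric_proj_def
proof (rule the_equality)
  have gap: "(dist p q)\<^sup>2 + (dist u p)\<^sup>2 \<le> (dist u q)\<^sup>2" if "q \<in> S" for q
    using dist_sq_add_le_if_inner_nonneg[OF angle[OF that]] .
  have "dist u p \<le> dist u q" if "q \<in> S" for q
  proof (rule power2_le_imp_le)
    show "(dist u p)\<^sup>2 \<le> (dist u q)\<^sup>2"
      by (rule order_trans[OF _ gap[OF that]]) simp
  qed simp
  with \<open>p \<in> S\<close> show "p \<in> S \<and> (\<forall>q\<in>S. dist u p \<le> dist u q)"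
    by blast
  fix q
  assume q: "q \<in> S \<and> (\<forall>r\<in>S. dist u q \<le> dist u r)"
  with \<open>p \<in> S\<close> have "(dist u q)\<^sup>2 \<le> (dist u p)\<^sup>2"
    by (intro power_mono) auto
  with gap[of q] q have "(dist p q)\<^sup>2 \<le> 0"
    by linarith
  then show "q = p"
    by simp
qed

lemma resolvent_dist_sq_le_resolvent:
  fixes A :: "'a::{real_inner, complete_space} \<Rightarrow> 'a set"
  assumes "maximal_monotone_op A" "0 < b" "b \<le> c"
  shows "(dist (resolvent b A u) (resolvent c A u))\<^sup>2 + (dist u (resolvent b A u))\<^sup>2 \<le>
    (dist u (resolvent c A u))\<^sup>2"
proof (rule dist_sq_add_le_if_inner_nonneg, rule inner_resolvent_nonneg)
  show "(1 / c) *\<^sub>R (u - resolvent c A u) \<in> A (resolvent c A u)"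
    using assms by (intro resolvent_mem) auto
qed (use assms in simp_all)

lemma inner_resolvent_zero_nonneg:
  fixes A :: "'a::{real_inner, complete_space} \<Rightarrow> 'a set"
  assumes "maximal_monotone_op A" "0 < b" "p \<in> op_inverse A 0"
  shows "0 \<le> (resolvent b A u - p) \<bullet> (u - resolvent b A u)"
  using inner_resolvent_nonneg[of A b 0 u p] assms by (simp add: mem_op_inverse_iff)

lemma convergent_resolvent_Suc:
  fixes A :: "'a::{real_inner, complete_space} \<Rightarrow> 'a set"
  assumes max: "maximal_monotone_op A" and "op_inverse A 0 \<noteq> {}"
  shows "convergent (\<lambda>n. resolvent (real (Suc n)) A u)"
proof -
  define J where "J = (\<lambda>n. resolvent (real (Suc n)) A u)"
  have gap: "(dist (J m) (J n))\<^sup>2 \<le> (dist u (J n))\<^sup>2 - (dist u (J m))\<^sup>2" if "m \<le> n" for m n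
    using resolvent_dist_sq_le_resolvent[OF max, of "real (Suc m)" "real (Suc n)" u] that
    by (simp add: J_def)
  obtain p where "p \<in> op_inverse A 0"
    using \<open>op_inverse A 0 \<noteq> {}\<close> by blast
  have bound: "(dist u (J n))\<^sup>2 \<le> (dist u p)\<^sup>2" for n
  proof (rule order_trans[OF _ dist_sq_add_le_if_inner_nonneg])
    show "0 \<le> (J n - p) \<bullet> (u - J n)"
      unfolding J_def using inner_resolvent_zero_nonneg[OF max _ \<open>p \<in> op_inverse A 0\<close>] by simp
  qed simp
  have "incseq (\<lambda>n. (dist u (J n))\<^sup>2)"
    by (intro monoI) (use gap in \<open>smt (verit) zero_le_power2\<close>)
  then obtain L where lim: "(\<lambda>n. (dist u (J n))\<^sup>2) \<longlonglongrightarrow> L" and upper: "\<And>n. (dist u (J n))\<^sup>2 \<le> L"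
    using incseq_convergent[of "\<lambda>n. (dist u (J n))\<^sup>2"] bound by blast
  have "Cauchy J"
  proof (rule Cauchy_if_dist_sq_le)
    show "(\<lambda>n. L - (dist u (J n))\<^sup>2) \<longlonglongrightarrow> 0"
      using tendsto_diff[OF tendsto_const lim, of L] by simp
    show "(dist (J m) (J n))\<^sup>2 \<le> L - (dist u (J m))\<^sup>2 + (L - (dist u (J n))\<^sup>2)" if "m \<le> n" for m n
      using gap[OF that] upper[of n] by linarith
  qed
  then show ?thesis
    by (simp add: Cauchy_convergent_iff J_def)
qed

lemma resolvent_limit_mem_zeros:
  fixes A :: "'a::{real_inner, complete_space} \<Rightarrow> 'a set" and \<beta> :: "nat \<Rightarrow> real"
  assumes max: "maximal_monotone_op A" and pos: "\<And>n. \<beta> n > 0"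
    and \<beta>: "filterlim \<beta> at_top sequentially" and p: "(\<lambda>n. resolvent (\<beta> n) A u) \<longlonglongrightarrow> p"
  shows "p \<in> op_inverse A 0"
proof -
  have "(\<lambda>n. (1 / \<beta> n) *\<^sub>R (u - resolvent (\<beta> n) A u)) \<longlonglongrightarrow> 0 *\<^sub>R (u - p)"
    by (intro tendsto_intros p tendsto_divide_0[OF tendsto_const]
        filterlim_at_top_imp_at_infinity \<beta>)
  then have lim: "(\<lambda>n. (resolvent (\<beta> n) A u, (1 / \<beta> n) *\<^sub>R (u - resolvent (\<beta> n) A u))) \<longlonglongrightarrow> (p, 0)"
    using tendsto_Pair[OF p] by simp
  have graph: "(resolvent (\<beta> n) A u, (1 / \<beta> n) *\<^sub>R (u - resolvent (\<beta> n) A u)) \<in> op_graph A" for n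
    using resolvent_mem[OF max pos] by (simp add: mem_op_graph_iff)
  have "(p, 0) \<in> op_graph A"
    by (rule closed_sequentially[OF closed_op_graph[OF max] graph lim])
  then show ?thesis
    by (simp add: mem_op_graph_iff mem_op_inverse_iff)
qed

lemma resolvent_limit_eq_metric_proj:
  fixes A :: "'a::{real_inner, complete_space} \<Rightarrow> 'a set" and \<beta> :: "nat \<Rightarrow> real"
  assumes max: "maximal_monotone_op A" and pos: "\<And>n. \<beta> n > 0"
    and \<beta>: "filterlim \<beta> at_top sequentially" and p: "(\<lambda>n. resolvent (\<beta> n) A u) \<longlonglongrightarrow> p"
  shows "metric_proj (op_inverse A 0) u = p"
proof (rule metric_proj_eqI)
  show "p \<in> op_inverse A 0"
    by (rule resolvent_limit_mem_zeros[OF assms])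
next
  fix q
  assume "q \<in> op_inverse A 0"
  then have "0 \<le> (resolvent (\<beta> n) A u - q) \<bullet> (u - resolvent (\<beta> n) A u)" for n
    by (rule inner_resolvent_zero_nonneg[OF max pos])
  moreover have "(\<lambda>n. (resolvent (\<beta> n) A u - q) \<bullet> (u - resolvent (\<beta> n) A u)) \<longlonglongrightarrow>
      (p - q) \<bullet> (u - p)"
    by (intro tendsto_intros p)
  ultimately show "0 \<le> (p - q) \<bullet> (u - p)"
    by (intro LIMSEQ_le_const) auto
qed

lemma resolvent_tendsto_at_topI:
  fixes A :: "'a::{real_inner, complete_space} \<Rightarrow> 'a set"
  assumes max: "maximal_monotone_op A" and zero: "p \<in> op_inverse A 0"
    and pos: "\<And>n. \<beta> n > 0" and p: "(\<lambda>n. resolvent (\<beta> n) A u) \<longlonglongrightarrow> p"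
  shows "((\<lambda>c. resolvent c A u) \<longlongrightarrow> p) at_top"
proof (rule tendstoI)
  fix \<epsilon> :: real
  assume "\<epsilon> > 0"
  have "(\<lambda>n. (dist u (resolvent (\<beta> n) A u))\<^sup>2) \<longlonglongrightarrow> (dist u p)\<^sup>2"
    by (intro tendsto_intros p)
  then have "\<forall>\<^sub>F n in sequentially. (dist u p)\<^sup>2 - \<epsilon>\<^sup>2 < (dist u (resolvent (\<beta> n) A u))\<^sup>2"
    by (rule order_tendstoD(1)) (use \<open>\<epsilon> > 0\<close> in simp)
  then obtain n where n: "(dist u p)\<^sup>2 - \<epsilon>\<^sup>2 < (dist u (resolvent (\<beta> n) A u))\<^sup>2"
    by (auto simp: eventually_sequentially)
  have "dist (resolvent c A u) p < \<epsilon>" if "c \<ge> \<beta> n" for c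
  proof (rule power_less_imp_less_base)
    have "(dist u (resolvent (\<beta> n) A u))\<^sup>2 \<le> (dist u (resolvent c A u))\<^sup>2"
      by (rule order_trans[OF _ resolvent_dist_sq_le_resolvent[OF max pos that]]) simp
    moreover have "c > 0"
      using pos[of n] that by linarith
    then have "(dist (resolvent c A u) p)\<^sup>2 + (dist u (resolvent c A u))\<^sup>2 \<le> (dist u p)\<^sup>2"
      by (intro dist_sq_add_le_if_inner_nonneg inner_resolvent_zero_nonneg max zero)
    ultimately show "(dist (resolvent c A u) p)\<^sup>2 < \<epsilon>\<^sup>2"
      using n by linarith
  qed (use \<open>\<epsilon> > 0\<close> in simp)
  then show "\<forall>\<^sub>F c in at_top. dist (resolvent c A u) p < \<epsilon>"
    by (rule eventually_at_top_linorderI)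
qed

theorem resolvent_tendsto_metric_proj:
  fixes A :: "'a::{real_inner, complete_space} \<Rightarrow> 'a set"
  assumes max: "maximal_monotone_op A" and nonempty: "op_inverse A 0 \<noteq> {}"
  shows "((\<lambda>c. resolvent c A u) \<longlongrightarrow> metric_proj (op_inverse A 0) u) at_top"
proof -
  obtain p where p: "(\<lambda>n. resolvent (real (Suc n)) A u) \<longlonglongrightarrow> p"
    using convergent_resolvent_Suc[OF assms] by (auto simp: convergent_def)
  have pos: "real (Suc n) > 0" for n
    by simp
  have top: "filterlim (\<lambda>n. real (Suc n)) at_top sequentially"
    by (rule filterlim_compose[OF filterlim_real_sequentially filterlim_Suc])
  show ?thesis
    unfolding resolvent_limit_eq_metric_proj[OF max pos top p]
    by (rule resolvent_tendsto_at_topI[OF max resolvent_limit_mem_zeros[OF max pos top p] pos p])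
qed

section \<open>Perturbed iteration of nonexpansive maps\<close>

lemma linear_recursion_tendsto_zero:
  fixes s a d :: "nat \<Rightarrow> real"
  assumes s: "\<And>n. 0 \<le> s n" and a: "\<And>n. 0 \<le> a n" and "a \<longlonglongrightarrow> 0" "d \<longlonglongrightarrow> 0"
    and rec: "\<And>n. s (Suc n) \<le> a n * s n + d n"
  shows "s \<longlonglongrightarrow> 0"
proof -
  have "\<forall>\<^sub>F n in sequentially. a n < 1/2 \<and> d n < 1"
    using order_tendstoD(2)[OF \<open>a \<longlonglongrightarrow> 0\<close>, of "1/2"] order_tendstoD(2)[OF \<open>d \<longlonglongrightarrow> 0\<close>, of 1]
    by (simp add: eventually_conj)
  then obtain N where N: "\<And>n. n \<ge> N \<Longrightarrow> a n < 1/2 \<and> d n < 1"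
    by (auto simp: eventually_sequentially)
  define M where "M = max (s N) 2"
  have bound: "s n \<le> M" if "n \<ge> N" for n
    using that
  proof (induction n rule: dec_induct)
    case (step n)
    have "a n * s n \<le> 1/2 * M"
      using step N[of n] s a by (intro mult_mono) (auto simp: M_def)
    moreover have "d n < 1" "M \<ge> 2"
      using step N by (auto simp: M_def)
    ultimately show ?case
      using rec[of n] by linarith
  qed (simp add: M_def)
  have "s (Suc n) \<le> a n * M + d n" if "n \<ge> N" for n
    using rec[of n] mult_left_mono[OF bound[OF that] a[of n]] by linarith
  then have upper: "\<forall>\<^sub>F n in sequentially. s (Suc n) \<le> a n * M + d n"
    by (auto simp: eventually_sequentially)
  have "(\<lambda>n. a n * M + d n) \<longlonglongrightarrow> 0 * M + 0"
    by (intro tendsto_intros \<open>a \<longlonglongrightarrow> 0\<close> \<open>d \<longlonglongrightarrow> 0\<close>)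
  then have "(\<lambda>n. s (Suc n)) \<longlonglongrightarrow> 0"
    using s by (intro tendsto_sandwich[OF _ upper tendsto_const]) simp_all
  then show ?thesis
    by (simp add: filterlim_sequentially_Suc)
qed

lemma nonexpansive_perturbed_iteration_tendsto:
  fixes T :: "nat \<Rightarrow> 'a::real_normed_vector \<Rightarrow> 'a" and \<alpha> :: "nat \<Rightarrow> real" and w x :: "nat \<Rightarrow> 'a"
  assumes nonexpansive: "\<And>n y z. dist (T n y) (T n z) \<le> dist y z"
    and T: "(\<lambda>n. T n u) \<longlonglongrightarrow> p" and w: "w \<longlonglongrightarrow> u" and \<alpha>: "\<alpha> \<longlonglongrightarrow> 0"
    and rec: "\<And>n. x (Suc n) = T n (w n + \<alpha> n *\<^sub>R x n)"
  shows "x \<longlonglongrightarrow> p"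
proof -
  define d where "d n = norm (w n + \<alpha> n *\<^sub>R p - u) + dist (T n u) p" for n
  have "(\<lambda>n. dist (x n) p) \<longlonglongrightarrow> 0"
  proof (rule linear_recursion_tendsto_zero)
    show "(\<lambda>n. \<bar>\<alpha> n\<bar>) \<longlonglongrightarrow> 0"
      using \<alpha> by (rule tendsto_rabs_zero)
    have "d \<longlonglongrightarrow> norm (u + 0 *\<^sub>R p - u) + dist p p"
      unfolding d_def by (intro tendsto_intros w \<alpha> T)
    then show "d \<longlonglongrightarrow> 0"
      by simp
  next
    fix n
    have "dist (x (Suc n)) (T n u) \<le> norm (\<alpha> n *\<^sub>R (x n - p) + (w n + \<alpha> n *\<^sub>R p - u))"
      using nonexpansive[of n "w n + \<alpha> n *\<^sub>R x n" u] by (simp add: rec dist_norm algebra_simps)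
    also have "\<dots> \<le> \<bar>\<alpha> n\<bar> * dist (x n) p + norm (w n + \<alpha> n *\<^sub>R p - u)"
      using norm_triangle_ineq by (metis dist_norm norm_scaleR)
    finally show "dist (x (Suc n)) p \<le> \<bar>\<alpha> n\<bar> * dist (x n) p + d n"
      using dist_triangle[of "x (Suc n)" p "T n u"] by (simp add: d_def)
  qed simp_all
  then show ?thesis
    by (rule tendsto_dist_iff[THEN iffD2])
qed

theorem theorem2p1:
  fixes A :: "'a::{real_inner, complete_space} \<Rightarrow> 'a set"
    and F :: "'a set"
    and \<beta> \<alpha> :: "nat \<Rightarrow> real"
    and e u x :: "nat \<Rightarrow> 'a"
    and u_lim x0 :: 'a
  assumes "maximal_monotone_op A"
    and "F = op_inverse A 0"
    and "F \<noteq> {}"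
    and "\<And>n. \<beta> n > 0"
    and "filterlim \<beta> at_top sequentially"
    and "\<alpha> \<longlonglongrightarrow> 0"
    and "(\<lambda>n. \<alpha> n *\<^sub>R e n) \<longlonglongrightarrow> 0"
    and "u \<longlonglongrightarrow> u_lim"
    and "x 0 = x0"
    and "\<And>n. x (Suc n) = resolvent (\<beta> n) A (u n + \<alpha> n *\<^sub>R (x n + e n))"
  shows "x \<longlonglongrightarrow> metric_proj F u_lim"
proof (rule nonexpansive_perturbed_iteration_tendsto)
  show "dist (resolvent (\<beta> n) A y) (resolvent (\<beta> n) A z) \<le> dist y z" for n y z
    using assms(1,4) by (rule resolvent_nonexpansive)
  have "((\<lambda>c. resolvent c A u_lim) \<longlongrightarrow> metric_proj F u_lim) at_top"
    using resolvent_tendsto_metric_proj assms(1-3) by simp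
  then show "(\<lambda>n. resolvent (\<beta> n) A u_lim) \<longlonglongrightarrow> metric_proj F u_lim"
    using assms(5) by (rule filterlim_compose)
  show "(\<lambda>n. u n + \<alpha> n *\<^sub>R e n) \<longlonglongrightarrow> u_lim"
    using tendsto_add[OF assms(8,7)] by simp
  show "x (Suc n) = resolvent (\<beta> n) A (u n + \<alpha> n *\<^sub>R e n + \<alpha> n *\<^sub>R x n)" for n
    by (simp add: assms(10) algebra_simps)
qed (rule assms(6))

end
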